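(* Let $n\ge 1$ and let $C\le \mathbb{F}_2^n$ be a binary linear code which is self-dual ($C=C^{\perp}$ with respect to the standard scalar product $b(x,y)=\sum_{i=1}^n x_iy_i$) and doubly-even (the Hamming weight of every codeword is divisible by $4$). Then the automorphism group $\mathrm{Aut}(C)=\{\pi\in \mathrm{Sym}_n \mid C\pi=C\}$ is contained in the alternating group $\mathrm{Alt}_n$.
   Context: $\mathrm{Sym}_n$ acts on $\mathbb{F}_2^n$ by permuting coordinates. $C^{\perp}=\{v\in\mathbb{F}_2^n\mid b(v,c)=0 \text{ for all } c\in C\}$. *)

theory Defs
  imports
    "HOL-Analysis.Analysis"
    "HOL-Library.Z2"
    "HOL-Combinatorics.Permutations"
begin

text \<open>
  The space \<open>F\<^sub>2\<^sup>n\<close> is \<open>bit ^ 'n\<close> with \<open>n = CARD('n) \<ge> 1\<close>; a binary linear code is a set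
  \<open>C :: (bit ^ 'n) set\<close> with \<open>vec.subspace C\<close>.
\<close>

definition scalar_prod :: "bit ^ 'n \<Rightarrow> bit ^ 'n \<Rightarrow> bit" where
  "scalar_prod x y = (\<Sum>i\<in>UNIV. x $ i * y $ i)"

definition dual_code :: "(bit ^ 'n) set \<Rightarrow> (bit ^ 'n) set" where
  "dual_code C = {v. \<forall>c\<in>C. scalar_prod v c = 0}"

definition self_dual :: "(bit ^ 'n) set \<Rightarrow> bool" where
  "self_dual C \<longleftrightarrow> C = dual_code C"

definition hamming_weight :: "bit ^ 'n \<Rightarrow> nat" where
  "hamming_weight v = card {i. v $ i \<noteq> 0}"

definition doubly_even :: "(bit ^ 'n) set \<Rightarrow> bool" where
  "doubly_even C \<longleftrightarrow> (\<forall>c\<in>C. 4 dvd hamming_weight c)"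

text \<open>
  The right action: \<open>v \<pi>\<close> carries the entry of \<open>v\<close> at \<open>i\<close> to position \<open>\<pi> i\<close>, hence the inverse.
\<close>

definition permute_coords :: "bit ^ 'n \<Rightarrow> ('n \<Rightarrow> 'n) \<Rightarrow> bit ^ 'n" where
  "permute_coords v \<pi> = (\<chi> i. v $ (inv \<pi> i))"

definition Sym :: "('n \<Rightarrow> 'n) set" where
  "Sym = {\<pi>. \<pi> permutes UNIV}"

definition Alt :: "('n \<Rightarrow> 'n) set" where
  "Alt = {\<pi> \<in> Sym. evenperm \<pi>}"

definition code_Aut :: "(bit ^ 'n) set \<Rightarrow> ('n \<Rightarrow> 'n) set" where
  "code_Aut C = {\<pi> \<in> Sym. (\<lambda>v. permute_coords v \<pi>) ` C = C}"

end

theory Submission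
  imports Defs
begin

text \<open>
  For doubly-even self-dual codes \<open>C\<close> and \<open>D\<close>, applying a transposition to \<open>D\<close> either doubles or
  halves \<open>card (C \<inter> D)\<close>. Hence the parity of the exponent of 2 in \<open>card (C \<inter> C\<pi>)\<close> changes with
  each factor when \<open>\<pi>\<close> is written as a product of transpositions, and if \<open>C\<pi> = C\<close> the number
  of factors is even. To see the doubling or halving for the transposition of \<open>a\<close> and \<open>b\<close>, let
  \<open>u = e\<^sub>a + e\<^sub>b\<close>. The transposition fixes the words of \<open>D\<close> orthogonal to \<open>u\<close> and adds \<open>u\<close> to the
  others, so one has to show that exactly one of \<open>C\<close>, \<open>C + u\<close> meets the set of words of \<open>D\<close> not
  orthogonal to \<open>u\<close>. They cannot both do so, because adding \<open>u\<close> to a word orthogonal to it changes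
  the weight by 2 modulo 4; at least one does by duality.
\<close>

section \<open>Linear algebra over the field with two elements\<close>

instance bit :: finite
proof
  have "(UNIV :: bit set) \<subseteq> {0, 1}"
    by (metis UNIV_I bit_not_zero_iff insertCI subsetI)
  then show "finite (UNIV :: bit set)"
    by (rule finite_subset) simp
qed

text \<open>These rules would turn sums and products of bits into bitwise operations, to which ring
  laws and lemmas on finite sums do not apply.\<close>

declare add_bit_eq_xor [simp del] mult_bit_eq_and [simp del]

lemma bit_add_self [simp]: "(x :: bit) + x = 0"
  by (cases x) simp_all

lemma bit_vec_add_self [simp]: "(x :: bit ^ 'n) + x = 0"
  by (simp add: vec_eq_iff)

lemma bit_vec_add_cancel [simp]: "(x :: bit ^ 'n) + (x + y) = y" "(x + y) + y = x"
  by (simp_all add: add.assoc flip: add.assoc[of x x])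

lemma scalar_prod_commute: "scalar_prod x y = scalar_prod y x"
  by (simp add: scalar_prod_def mult.commute)

lemma scalar_prod_add_left: "scalar_prod (x + y) z = scalar_prod x z + scalar_prod y z"
  by (simp add: scalar_prod_def distrib_right sum.distrib)

lemma scalar_prod_add_right: "scalar_prod x (y + z) = scalar_prod x y + scalar_prod x z"
  by (simp add: scalar_prod_def distrib_left sum.distrib)

lemma scalar_prod_0_right [simp]: "scalar_prod x 0 = 0"
  by (simp add: scalar_prod_def)

lemma bit_subspaceI:
  fixes V :: "(bit ^ 'n) set"
  assumes "0 \<in> V" and "\<And>x y. x \<in> V \<Longrightarrow> y \<in> V \<Longrightarrow> x + y \<in> V"
  shows "vec.subspace V"
proof (rule vec.subspaceI)
  fix c :: bit and x assume "x \<in> V"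
  then show "c *s x \<in> V"
    using assms(1) by (cases c) simp_all
qed (use assms in auto)

lemma subspace_dual_code: "vec.subspace (dual_code C)"
  by (rule bit_subspaceI)
    (auto simp: dual_code_def scalar_prod_add_left scalar_prod_commute[of 0])

text \<open>Some linear functional vanishes on \<open>V\<close> but not at \<open>x\<close>, and
  every functional is the scalar product with a fixed vector.\<close>

lemma exists_dual_separating:
  fixes V :: "(bit ^ 'n::finite) set"
  assumes V: "vec.subspace V" and x: "x \<notin> V"
  obtains y where "y \<in> dual_code V" and "scalar_prod y x = 1"
proof -
  fix k :: 'n
  obtain B where B: "B \<subseteq> V" "vec.independent B" "V \<subseteq> vec.span B"
    by (rule vec.maximal_independent_subset)
  have "vec.span B \<subseteq> V"
    using B(1) V by (rule vec.span_minimal)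
  with x have "x \<notin> vec.span B"
    by blast
  with B(2) have "vec.independent (insert x B)"
    by (intro vec.independent_insertI)
  \<comment> \<open>The functional is coordinate \<open>k\<close>, chosen arbitrarily, of an
    endomorphism \<open>f\<close>; row \<open>k\<close> of the matrix of \<open>f\<close> is then
    the vector that represents it.\<close>
  then obtain f :: "bit ^ 'n \<Rightarrow> bit ^ 'n" where lin: "Vector_Spaces.linear (*s) (*s) f"
    and f: "\<forall>z\<in>insert x B. f z = (if z = x then axis k 1 else 0)"
    using vec.linear_independent_extend[of "insert x B" "\<lambda>z. if z = x then axis k 1 else 0"]
    by blast
  have prod: "scalar_prod (matrix f $ k) z = f z $ k" for z
    unfolding matrix_works[OF lin, of z, symmetric]
    by (simp add: scalar_prod_def matrix_vector_mult_def)
  have "f z = 0" if "z \<in> V" for z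
  proof -
    interpret f: Vector_Spaces.linear "(*s)" "(*s)" f
      by (rule lin)
    have "f b = 0" if "b \<in> B" for b
      using that f x B(1) by auto
    then show ?thesis
      using f.eq_0_on_span[of B z] that B(3) by blast
  qed
  with f show thesis
    by (intro that[of "matrix f $ k"]) (simp_all add: dual_code_def prod)
qed

section \<open>Transpositions and Hamming weights\<close>

definition pair_word :: "'n \<Rightarrow> 'n \<Rightarrow> bit ^ 'n" where
  "pair_word a b = axis a 1 + axis b 1"

lemma pair_word_nth:
  "a \<noteq> b \<Longrightarrow> pair_word a b $ i = (if i = a \<or> i = b then 1 else 0)"
  by (auto simp: pair_word_def axis_def)

lemma scalar_prod_pair_word:
  fixes x :: "bit ^ 'n::finite"
  shows "scalar_prod (pair_word a b) x = x $ a + x $ b"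
  by (simp add: scalar_prod_def pair_word_def axis_def distrib_right sum.distrib if_distrib[of "\<lambda>c. c * _"] cong: if_cong)

lemma scalar_prod_pair_word_self [simp]:
  "a \<noteq> b \<Longrightarrow> scalar_prod (pair_word a b) (pair_word a b) = 0"
  by (simp add: scalar_prod_pair_word pair_word_nth)

lemma permute_coords_transpose:
  fixes x :: "bit ^ 'n::finite"
  assumes "a \<noteq> b"
  shows "permute_coords x (Transposition.transpose a b) =
    (if scalar_prod (pair_word a b) x = 0 then x else x + pair_word a b)"
proof -
  have "x $ Transposition.transpose a b i = (if x $ a + x $ b = 0 then x else x + pair_word a b) $ i" for i
    using assms
    by (cases "x $ a"; cases "x $ b") (auto simp: pair_word_nth Transposition.transpose_def)
  then show ?thesis
    by (simp add: permute_coords_def vec_eq_iff scalar_prod_pair_word)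
qed

lemma hamming_weight_add_pair_word:
  fixes x :: "bit ^ 'n::finite"
  assumes ab: "a \<noteq> b" and "x $ a = 0" and "x $ b = 0"
  shows "hamming_weight (x + pair_word a b) = hamming_weight x + 2"
proof -
  have "{i. (x + pair_word a b) $ i \<noteq> 0} = insert a (insert b {i. x $ i \<noteq> 0})"
    using assms by (auto simp: pair_word_nth)
  then show ?thesis
    using assms by (simp add: hamming_weight_def)
qed

text \<open>Orthogonality means that \<open>x\<close> has equal entries at \<open>a\<close> and
  \<open>b\<close>. Flipping two equal entries changes the weight by exactly 2.\<close>

lemma not_both_weights_dvd_4:
  fixes x :: "bit ^ 'n::finite"
  assumes ab: "a \<noteq> b" and x: "scalar_prod (pair_word a b) x = 0"
    and "4 dvd hamming_weight x" and "4 dvd hamming_weight (x + pair_word a b)"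
  shows False
proof (cases "x $ a")
  case zero
  then have "x $ b = 0"
    using x by (simp add: scalar_prod_pair_word)
  then show False
    using hamming_weight_add_pair_word[OF ab zero] assms(3,4) by presburger
next
  case one
  then have "x $ b = 1"
    using x by (cases "x $ b") (simp_all add: scalar_prod_pair_word)
  \<comment> \<open>Now \<open>x + pair_word a b\<close> has zeros at \<open>a\<close> and
    \<open>b\<close>, so it takes the role of the lighter word.\<close>
  then show False
    using hamming_weight_add_pair_word[OF ab, of "x + pair_word a b"] one ab assms(3,4)
    by (simp add: pair_word_nth) presburger
qed

text \<open>Translation by \<open>c\<close> is an involution of \<open>X\<close> that exchanges the
  words orthogonal to \<open>u\<close> with the others.\<close>

lemma card_eq_twice_card_orthogonal:
  fixes X :: "(bit ^ 'n::finite) set"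
  assumes X: "\<And>x y. x \<in> X \<Longrightarrow> y \<in> X \<Longrightarrow> x + y \<in> X"
    and c: "c \<in> X" "scalar_prod u c = 1"
  shows "card X = 2 * card {x \<in> X. scalar_prod u x = 0}"
proof -
  let ?X0 = "{x \<in> X. scalar_prod u x = 0}" and ?X1 = "{x \<in> X. scalar_prod u x = 1}"
  have "bij_betw (\<lambda>x. x + c) ?X0 ?X1"
    using X c by (intro bij_betw_byWitness[where f' = "\<lambda>x. x + c"])
      (auto simp: scalar_prod_add_right)
  then have "card ?X1 = card ?X0"
    by (simp add: bij_betw_same_card)
  moreover have "X = ?X0 \<union> ?X1" "?X0 \<inter> ?X1 = {}"
    by auto
  ultimately show ?thesis
    using card_Un_disjoint[of ?X0 ?X1] by simp
qed

section \<open>The action of permutations on codes\<close>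

lemma permute_coords_id: "permute_coords x id = x"
  by (simp add: permute_coords_def vec_eq_iff)

lemma permute_coords_comp:
  "bij \<sigma> \<Longrightarrow> bij \<tau> \<Longrightarrow> permute_coords x (\<tau> \<circ> \<sigma>) = permute_coords (permute_coords x \<sigma>) \<tau>"
  by (simp add: permute_coords_def vec_eq_iff o_inv_distrib)

lemma permute_coords_inv:
  assumes "bij \<pi>"
  shows "permute_coords (permute_coords x \<pi>) (inv \<pi>) = x"
    and "permute_coords (permute_coords x (inv \<pi>)) \<pi> = x"
  using assms
  by (simp_all add: permute_coords_def vec_eq_iff inv_inv_eq bij_is_inj bij_is_surj surj_f_inv_f)

lemma scalar_prod_permute_coords:
  fixes x y :: "bit ^ 'n::finite"
  assumes "bij \<pi>"
  shows "scalar_prod (permute_coords x \<pi>) (permute_coords y \<pi>) = scalar_prod x y"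
  unfolding scalar_prod_def permute_coords_def
  using sum.reindex_bij_betw[OF bij_imp_bij_inv[OF assms], of "\<lambda>i. x $ i * y $ i"] by simp

lemma hamming_weight_permute_coords:
  fixes x :: "bit ^ 'n::finite"
  assumes "bij \<pi>"
  shows "hamming_weight (permute_coords x \<pi>) = hamming_weight x"
proof -
  have "bij_betw (inv \<pi>) {i. x $ inv \<pi> i \<noteq> 0} {i. x $ i \<noteq> 0}"
    using assms by (intro bij_betw_byWitness[where f' = \<pi>])
      (auto simp: bij_is_inj bij_is_surj surj_f_inv_f)
  then show ?thesis
    by (simp add: hamming_weight_def permute_coords_def bij_betw_same_card)
qed

definition permute_code :: "(bit ^ 'n) set \<Rightarrow> ('n \<Rightarrow> 'n) \<Rightarrow> (bit ^ 'n) set" where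
  "permute_code C \<pi> = (\<lambda>v. permute_coords v \<pi>) ` C"

lemma permute_code_id: "permute_code C id = C"
  unfolding permute_code_def permute_coords_id by simp

lemma permute_code_comp:
  "bij \<sigma> \<Longrightarrow> bij \<tau> \<Longrightarrow> permute_code C (\<tau> \<circ> \<sigma>) = permute_code (permute_code C \<sigma>) \<tau>"
  by (simp add: permute_code_def permute_coords_comp image_image)

text \<open>Permuting coordinates is an isometry, so \<open>\<pi>\<close> moves to the other side of
  the scalar product as its inverse.\<close>

lemma self_dual_permute_code:
  fixes C :: "(bit ^ 'n::finite) set"
  assumes \<pi>: "bij \<pi>" and C: "self_dual C"
  shows "self_dual (permute_code C \<pi>)"
proof -
  have mem: "v \<in> permute_code C \<pi> \<longleftrightarrow> permute_coords v (inv \<pi>) \<in> C" for v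
    unfolding permute_code_def by (metis (no_types, lifting) \<pi> image_iff permute_coords_inv)
  have prod: "scalar_prod v (permute_coords c \<pi>) = scalar_prod (permute_coords v (inv \<pi>)) c" for v c
    using scalar_prod_permute_coords[OF \<pi>, of "permute_coords v (inv \<pi>)" c] permute_coords_inv[OF \<pi>, of v]
    by simp
  have "v \<in> dual_code (permute_code C \<pi>) \<longleftrightarrow> permute_coords v (inv \<pi>) \<in> dual_code C" for v
    by (simp add: dual_code_def permute_code_def prod)
  then show ?thesis
    using C mem unfolding self_dual_def by blast
qed

lemma doubly_even_permute_code:
  fixes C :: "(bit ^ 'n::finite) set"
  shows "bij \<pi> \<Longrightarrow> doubly_even C \<Longrightarrow> doubly_even (permute_code C \<pi>)"
  by (simp add: doubly_even_def permute_code_def hamming_weight_permute_coords)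

section \<open>Intersections of self-dual codes\<close>

lemma self_dual_add:
  "self_dual C \<Longrightarrow> x \<in> C \<Longrightarrow> y \<in> C \<Longrightarrow> x + y \<in> C"
  using subspace_dual_code[of C] by (simp add: self_dual_def vec.subspace_add)

lemma self_dual_subspace: "self_dual C \<Longrightarrow> vec.subspace C"
  using subspace_dual_code[of C] by (simp add: self_dual_def)

text \<open>The dual of the intersection of \<open>C\<close> with the hyperplane orthogonal to
  \<open>u\<close> is the dual of \<open>C\<close>, that is \<open>C\<close> itself, enlarged by
  \<open>u\<close>.\<close>

lemma dual_code_section:
  fixes C :: "(bit ^ 'n::finite) set"
  assumes C: "self_dual C" and y: "y \<in> dual_code {c \<in> C. scalar_prod u c = 0}"
  shows "y \<in> C \<or> y + u \<in> C"
proof (rule disjCI)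
  assume "y + u \<notin> C"
  then obtain c where c: "c \<in> C" "scalar_prod y c \<noteq> scalar_prod u c"
    using C unfolding self_dual_def dual_code_def
    by (smt (verit, best) bit_add_self mem_Collect_eq scalar_prod_add_left)
  have y0: "scalar_prod y d = 0" if "d \<in> C" "scalar_prod u d = 0" for d
    using y that by (simp add: dual_code_def)
  then have c01: "scalar_prod y c = 0" "scalar_prod u c = 1"
    using c by (cases "scalar_prod u c"; cases "scalar_prod y c"; force)+
  \<comment> \<open>A word of \<open>C\<close> not orthogonal to \<open>u\<close> becomes orthogonal
    after adding \<open>c\<close>, and \<open>y\<close> is orthogonal to \<open>c\<close>.\<close>
  have "scalar_prod y d = 0" if "d \<in> C" for d
  proof (cases "scalar_prod u d")
    case one
    then have "scalar_prod y (d + c) = 0"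
      using that c c01 C by (intro y0) (simp_all add: self_dual_add scalar_prod_add_right)
    then show ?thesis
      by (simp add: scalar_prod_add_right c01)
  qed (use that y0 in blast)
  then show "y \<in> C"
    using C unfolding self_dual_def dual_code_def by blast
qed

text \<open>With \<open>C0\<close> the words of \<open>C\<close> orthogonal to \<open>u\<close>, the
  weights show that \<open>u\<close> is outside \<open>C0 + D\<close>. A word \<open>y\<close>
  separating the two is dual to \<open>C0\<close> and to \<open>D\<close>, so it lies in
  \<open>D\<close> and in \<open>C\<close> or \<open>C + u\<close>.\<close>

lemma exists_nonorthogonal_common:
  fixes C D :: "(bit ^ 'n::finite) set"
  assumes C: "self_dual C" "doubly_even C" and D: "self_dual D" "doubly_even D" and ab: "a \<noteq> b"
  obtains d where "d \<in> D" "scalar_prod (pair_word a b) d = 1" "d \<in> C \<or> d + pair_word a b \<in> C"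
proof -
  define u :: "bit ^ 'n" where "u = pair_word a b"
  define C0 where "C0 = {c \<in> C. scalar_prod u c = 0}"
  define V where "V = {c + d | c d. c \<in> C0 \<and> d \<in> D}"
  have C0: "vec.subspace C0"
    using vec.subspace_0[OF self_dual_subspace[OF C(1)]] self_dual_add[OF C(1)]
    by (intro bit_subspaceI) (auto simp: C0_def scalar_prod_add_right)
  have "vec.subspace V"
    unfolding V_def using vec.subspace_sums[OF C0 self_dual_subspace[OF D(1)]] by simp
  moreover have "u \<notin> V"
  proof
    assume "u \<in> V"
    then obtain c d where cd: "c \<in> C" "scalar_prod u c = 0" "d \<in> D" "u = c + d"
      by (auto simp: V_def C0_def)
    then have "c + u \<in> D"
      by simp
    with cd show False
      using not_both_weights_dvd_4[OF ab, of c] C(2) D(2) by (simp add: u_def doubly_even_def)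
  qed
  ultimately obtain y where y: "y \<in> dual_code V" "scalar_prod y u = 1"
    by (rule exists_dual_separating)
  have "C0 \<subseteq> V" "D \<subseteq> V"
    using vec.subspace_0[OF C0] vec.subspace_0[OF self_dual_subspace[OF D(1)]]
    unfolding V_def by force+
  then have "y \<in> dual_code C0" "y \<in> dual_code D"
    using y(1) by (auto simp: dual_code_def)
  then have "y \<in> dual_code C0" "y \<in> D"
    using D(1) by (simp_all add: self_dual_def)
  moreover from this have "y \<in> C \<or> y + u \<in> C"
    using dual_code_section[OF C(1)] by (simp add: C0_def)
  ultimately show thesis
    using that[of y] y(2) by (simp add: u_def scalar_prod_commute)
qed

lemma card_inter_permute_code_transpose:
  fixes C D :: "(bit ^ 'n::finite) set"
  assumes C: "self_dual C" "doubly_even C" and D: "self_dual D" "doubly_even D" and ab: "a \<noteq> b"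
  shows "card (C \<inter> permute_code D (Transposition.transpose a b)) = 2 * card (C \<inter> D) \<or>
    card (C \<inter> D) = 2 * card (C \<inter> permute_code D (Transposition.transpose a b))"
proof -
  define u :: "bit ^ 'n" where "u = pair_word a b"
  define D' where "D' = permute_code D (Transposition.transpose a b)"
  define S where "S = {x \<in> C \<inter> D. scalar_prod u x = 0}"
  have uu: "scalar_prod u u = 0"
    using ab by (simp add: u_def)
  have D': "self_dual D'"
    unfolding D'_def using D(1) by (intro self_dual_permute_code) simp_all
  have mem_D': "x \<in> D' \<longleftrightarrow> (if scalar_prod u x = 0 then x else x + u) \<in> D" for x
  proof -
    have "x \<in> D' \<longleftrightarrow> permute_coords x (Transposition.transpose a b) \<in> D"
      unfolding D'_def permute_code_def
      by (metis (no_types, lifting) bij_transpose image_iff inv_transpose_eq permute_coords_inv(1))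
    then show ?thesis
      by (simp add: permute_coords_transpose[OF ab] u_def)
  qed
  \<comment> \<open>Both intersections have the same part \<open>S\<close> orthogonal to
    \<open>u\<close>. By \<open>excl\<close> at most one of them is larger than \<open>S\<close>,
    and the word \<open>d\<close> shows that one is.\<close>
  have S': "{x \<in> C \<inter> D'. scalar_prod u x = 0} = S"
    by (auto simp: S_def mem_D')
  have excl: False if "c \<in> C \<inter> D" "scalar_prod u c = 1" "c' \<in> C \<inter> D'" "scalar_prod u c' = 1" for c c'
  proof -
    have "c + c' \<in> C" "c + c' + u \<in> D"
      using that self_dual_add[OF C(1)] self_dual_add[OF D(1), of c "c' + u"]
      by (auto simp: mem_D' add.assoc)
    then show False
      using not_both_weights_dvd_4[OF ab, of "c + c'"] C(2) D(2) that
      by (simp add: u_def doubly_even_def scalar_prod_add_right)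
  qed
  have sumD: "x + y \<in> C \<inter> D" if "x \<in> C \<inter> D" "y \<in> C \<inter> D" for x y
    using that self_dual_add C(1) D(1) by blast
  have sumD': "x + y \<in> C \<inter> D'" if "x \<in> C \<inter> D'" "y \<in> C \<inter> D'" for x y
    using that self_dual_add C(1) D' by blast
  obtain d where d: "d \<in> D" "scalar_prod u d = 1" "d \<in> C \<or> d + u \<in> C"
    using exists_nonorthogonal_common[OF C D ab] unfolding u_def by metis
  from d(3) show ?thesis
  proof
    assume "d \<in> C"
    then have "card (C \<inter> D) = 2 * card S"
      unfolding S_def using d sumD by (intro card_eq_twice_card_orthogonal[of _ d]) auto
    moreover have "C \<inter> D' = S"
      using excl[of d] d \<open>d \<in> C\<close> unfolding S'[symmetric] bit_not_one_iff[symmetric] by blast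
    ultimately show ?thesis
      by (simp add: D'_def)
  next
    assume "d + u \<in> C"
    \<comment> \<open>The transposition sends \<open>d\<close> to \<open>d + u\<close>.\<close>
    then have d': "d + u \<in> C \<inter> D'" "scalar_prod u (d + u) = 1"
      using d by (simp_all add: mem_D' scalar_prod_add_right uu)
    then have "card (C \<inter> D') = 2 * card S"
      unfolding S'[symmetric] using sumD' by (intro card_eq_twice_card_orthogonal[of _ "d + u"]) auto
    moreover have "C \<inter> D = S"
      using excl[OF _ _ d'] unfolding S_def bit_not_one_iff[symmetric] by blast
    ultimately show ?thesis
      by (simp add: D'_def)
  qed
qed

text \<open>The summand for \<open>card C\<close> makes the total even at the identity, where the
  induction over transpositions starts.\<close>

lemma even_multiplicity_card_inter_iff:
  fixes C :: "(bit ^ 'n::finite) set"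
  assumes C: "self_dual C" "doubly_even C" and \<pi>: "\<pi> permutes UNIV"
  shows "even (multiplicity 2 (card (C \<inter> permute_code C \<pi>)) + multiplicity 2 (card C))
    \<longleftrightarrow> evenperm \<pi>"
  using \<pi> finite
proof (induction rule: permutes_induct)
  case id
  then show ?case
    unfolding permute_code_id by simp
next
  case (swap a b p)
  define D where "D = permute_code C p"
  have p: "bij p"
    using swap.hyps by (simp add: permutes_bij)
  have D: "self_dual D" "doubly_even D"
    unfolding D_def using C p by (simp_all add: self_dual_permute_code doubly_even_permute_code)
  define D' where "D' = permute_code D (Transposition.transpose a b)"
  have D': "self_dual D'"
    unfolding D'_def using D by (intro self_dual_permute_code) simp_all
  \<comment> \<open>The zero word is common to both codes. Doubling raises the exponent of 2 only
    for nonzero numbers, since \<open>multiplicity 2 0\<close> is \<open>0\<close> by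
    convention.\<close>
  have pos: "card (C \<inter> E) \<noteq> 0" if "self_dual E" for E
    using vec.subspace_0[OF self_dual_subspace[OF C(1)]] vec.subspace_0[OF self_dual_subspace[OF that]]
    by (auto simp: card_eq_0_iff)
  have "even (multiplicity 2 (card (C \<inter> D'))) \<longleftrightarrow> odd (multiplicity 2 (card (C \<inter> D)))"
    using card_inter_permute_code_transpose[OF C D swap.hyps(3), folded D'_def]
  proof
    assume "card (C \<inter> D') = 2 * card (C \<inter> D)"
    then show ?thesis
      using multiplicity_times_same[of "card (C \<inter> D)" 2] pos[OF D(1)] by simp
  next
    assume "card (C \<inter> D) = 2 * card (C \<inter> D')"
    then show ?thesis
      using multiplicity_times_same[of "card (C \<inter> D')" 2] pos[OF D'] by simp
  qed
  moreover have "evenperm (Transposition.transpose a b \<circ> p) \<longleftrightarrow> \<not> evenperm p"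
    using swap.hyps
    by (subst evenperm_comp)
      (auto simp: permutation_swap_id evenperm_swap intro: permutes_imp_permutation[OF finite])
  moreover have "permute_code C (Transposition.transpose a b \<circ> p) = D'"
    unfolding D'_def D_def using p by (intro permute_code_comp) simp_all
  ultimately show ?case
    using swap.IH unfolding D_def by (metis even_add)
qed

theorem theorem5p1:
  fixes C :: "(bit ^ 'n::finite) set"
  assumes "vec.subspace C"
    and "self_dual C"
    and "doubly_even C"
  shows "code_Aut C \<subseteq> Alt"
proof
  fix \<pi> assume "\<pi> \<in> code_Aut C"
  then have \<pi>: "\<pi> permutes UNIV" "permute_code C \<pi> = C"
    by (auto simp: code_Aut_def Sym_def permute_code_def)
  then show "\<pi> \<in> Alt"
    \<comment> \<open>As \<open>\<pi>\<close> preserves \<open>C\<close>, both exponents are equal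
      and their sum is even.\<close>
    using even_multiplicity_card_inter_iff[OF assms(2,3) \<pi>(1)]
    by (simp add: Alt_def Sym_def)
qed

end
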